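(* For almost every real symmetric $2\times2\times2$ tensor $X$ (i.e. for a generic symmetric $X$), if $Y$ is a best symmetric rank-1 approximation of $X$, then $X-Y$ lies in the symmetric orbit $D_3$.
   Context: Tensors are real arrays $X=(X_{ijk})\in\mathbb{R}^{2\times2\times2}$, written $X=[X_1\,|\,X_2]$ with slabs $(X_k)_{ij}=X_{ijk}$. $X$ is symmetric if $X_{ijk}$ is invariant under all permutations of its indices; such tensors have the form $$X=\left[\begin{array}{cc|cc}a&b&b&c\\ b&c&c&d\end{array}\right]$$ and form a 4-dimensional real vector space. The Frobenius norm is $\|X\|^2=\sum_{ijk}X_{ijk}^2$, and $y\otimes y\otimes y$ has entries $y_iy_jy_k$. A best symmetric rank-1 approximation of $X$ is a tensor $Y=y\otimes y\otimes y$ where $y$ minimizes $\|X-y\otimes y\otimes y\|^2$ over $y\in\mathbb{R}^2$ (a minimizer always exists). For a $2\times2$ matrix $S$, $(S,S,S)\cdot X$ has entries $\sum_{pqr}S_{ip}S_{jq}S_{kr}X_{pqr}$. The symmetric orbit $D_3$ is the set of all tensors $(S,S,S)\cdot C$ with $S$ a real invertible $2\times2$ matrix, where $$C=\left[\begin{array}{cc|cc}0&1&1&0\\1&0&0&0\end{array}\right].$$ "Generic" and "almost every/almost all" refer to Lebesgue measure on the 4-dimensional space of symmetric tensors (coordinates $(a,b,c,d)$): the property holds for all symmetric $X$ outside a set of measure zero. *)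

theory Defs
  imports "HOL-Analysis.Analysis"
begin

text \<open>A tensor \<open>X\<close> has entries \<open>X\<^sub>i\<^sub>j\<^sub>k = X $ i $ j $ k\<close>; its slabs are taken along the last index.\<close>

type_synonym tensor = "real^2^2^2"

definition of_slabs :: "real^2^2 \<Rightarrow> real^2^2 \<Rightarrow> tensor" where
  "of_slabs X1 X2 = (\<chi> i j k. if k = 1 then X1 $ i $ j else X2 $ i $ j)"

definition symmetric_tensor :: "tensor \<Rightarrow> bool" where
  "symmetric_tensor X \<longleftrightarrow> (\<forall>i j k.
     X $ i $ k $ j = X $ i $ j $ k \<and> X $ j $ i $ k = X $ i $ j $ k \<and>
     X $ j $ k $ i = X $ i $ j $ k \<and> X $ k $ i $ j = X $ i $ j $ k \<and>
     X $ k $ j $ i = X $ i $ j $ k)"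

definition sym_tensor :: "real^4 \<Rightarrow> tensor" where
  "sym_tensor v = (let a = v $ 1; b = v $ 2; c = v $ 3; d = v $ 4 in
     of_slabs (vector [vector [a, b], vector [b, c]]) (vector [vector [b, c], vector [c, d]]))"

lemma bij_betw_sym_tensor: "bij_betw sym_tensor UNIV {X. symmetric_tensor X}"
proof -
  have i: "inj sym_tensor"
    by (rule injI)
      (simp add: sym_tensor_def of_slabs_def vec_eq_iff Let_def forall_2 forall_4 vector_2)
  have s: "symmetric_tensor (sym_tensor v)" for v
    by (simp add: symmetric_tensor_def sym_tensor_def of_slabs_def Let_def forall_2 vector_2)
  have r: "X \<in> range sym_tensor" if X: "symmetric_tensor X" for X
  proof
    have "X$1$2$1 = X$1$1$2" "X$2$1$1 = X$1$1$2" "X$2$1$2 = X$1$2$2" "X$2$2$1 = X$1$2$2"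
      using X unfolding symmetric_tensor_def by blast+
    then show "X = sym_tensor
        (\<chi> i. if i = 1 then X$1$1$1 else if i = 2 then X$1$1$2 else if i = 3 then X$1$2$2 else X$2$2$2)"
      by (simp add: sym_tensor_def of_slabs_def Let_def forall_2 vector_2 vec_eq_iff)
  qed simp
  from i s r show ?thesis unfolding bij_betw_def by blast
qed

text \<open>Almost every symmetric tensor, with respect to Lebesgue measure in the coordinates
  \<open>(a, b, c, d)\<close>.\<close>

definition almost_every_symmetric :: "(tensor \<Rightarrow> bool) \<Rightarrow> bool" where
  "almost_every_symmetric P \<longleftrightarrow> (AE v in lebesgue. P (sym_tensor v))"

definition cube :: "real^2 \<Rightarrow> tensor" where
  "cube y = (\<chi> i j k. y $ i * y $ j * y $ k)"

text \<open>The library norm on \<^typ>\<open>tensor\<close> is the Frobenius norm.\<close>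

lemma norm_tensor_sq: "(norm (X::tensor))\<^sup>2 = (\<Sum>i\<in>UNIV. \<Sum>j\<in>UNIV. \<Sum>k\<in>UNIV. (X $ i $ j $ k)\<^sup>2)"
  by (simp add: norm_vec_def L2_set_def sum_nonneg)

definition best_sym_rank1_approx :: "tensor \<Rightarrow> tensor \<Rightarrow> bool" where
  "best_sym_rank1_approx X Y \<longleftrightarrow>
     (\<exists>y. Y = cube y \<and> (\<forall>z. (norm (X - cube y))\<^sup>2 \<le> (norm (X - cube z))\<^sup>2))"

definition multilinear_mult ::
  "real^2^2 \<Rightarrow> real^2^2 \<Rightarrow> real^2^2 \<Rightarrow> tensor \<Rightarrow> tensor" where
  "multilinear_mult S T U X = (\<chi> i j k.
     \<Sum>p\<in>UNIV. \<Sum>q\<in>UNIV. \<Sum>r\<in>UNIV. S $ i $ p * T $ j $ q * U $ k $ r * X $ p $ q $ r)"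

definition C_tensor :: tensor where
  "C_tensor = of_slabs (vector [vector [0, 1], vector [1, 0]]) (vector [vector [1, 0], vector [0, 0]])"

definition D3 :: "tensor set" where
  "D3 = {multilinear_mult S S S C_tensor |S. invertible S}"

end

theory Submission
  imports Defs
begin

text \<open>
  Identify \<open>X\<close> with the binary cubic \<open>f = a x\<^sup>3 + 3 b x\<^sup>2 y + 3 c x y\<^sup>2 + d y\<^sup>3\<close>. If \<open>y\<close> is a nonzero
  minimizer and \<open>w\<close> is \<open>y\<close> rotated by a right angle, criticality says exactly that the residual
  cubic \<open>g\<close> satisfies \<open>g(y,y,\<cdot>) = 0\<close>. Hence \<open>g\<close> is the square of the linear form \<open>w\<close> times a linear
  form \<open>3 \<gamma> y + \<delta> w\<close>, which lies in the orbit unless \<open>\<gamma> = 0\<close>. In that case \<open>f\<close> is a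
  combination of the cubes of two orthogonal linear forms, so its Hessian covariant has trace zero:
  \<open>a c - b\<^sup>2 + b d - c\<^sup>2 = 0\<close>. This quadric has measure zero, and it also contains \<open>X = 0\<close>, the only
  tensor for which \<open>0\<close> is a minimizer.
\<close>

definition hessian_trace :: "real \<Rightarrow> real \<Rightarrow> real \<Rightarrow> real \<Rightarrow> real" where
  "hessian_trace a b c d = a * c - b\<^sup>2 + b * d - c\<^sup>2"

text \<open>Where \<open>v$2\<close> is nonzero the equation is linear in \<open>v$4\<close>, so the
  zero set is a graph over the hyperplane \<open>v$4 = 0\<close>: \<open>F\<close> inserts the
  solved value, and a differentiable image of a null set is null.\<close>

lemma negligible_hessian_trace_zero:
  "negligible {v::real^4. hessian_trace (v$1) (v$2) (v$3) (v$4) = 0}" (is "negligible ?Z")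
proof -
  define F where "F = (\<lambda>v::real^4. v + (((v$2)\<^sup>2 + (v$3)\<^sup>2 - v$1 * v$3) / v$2) *\<^sub>R axis 4 (1::real))"
  define H where "H = {v::real^4. v$4 = 0} \<inter> {v. v$2 \<noteq> 0}"
  have hyperplane: "negligible {v::real^4. v$i = 0}" for i
    using negligible_standard_hyperplane[of "axis i (1::real)" 0]
    by (simp add: axis_in_Basis_iff inner_axis)
  have "negligible H"
    unfolding H_def by (rule negligible_subset[OF hyperplane[of 4]]) auto
  moreover have "(\<lambda>v::real^4. v$i) differentiable (at x within H)" for i x
    by (rule bounded_linear_imp_differentiable[OF bounded_linear_vec_nth])
  then have "F differentiable_on H"
    unfolding F_def differentiable_on_def by (auto simp: H_def intro!: derivative_intros)
  ultimately have "negligible (F ` H)"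
    using negligible_differentiable_image_negligible[of H F] by simp
  moreover have "?Z \<subseteq> F ` H \<union> {v. v$2 = 0}"
  proof
    fix v assume "v \<in> ?Z"
    then have v: "v$1 * v$3 - (v$2)\<^sup>2 + v$2 * v$4 - (v$3)\<^sup>2 = 0"
      by (simp add: hessian_trace_def)
    show "v \<in> F ` H \<union> {v. v$2 = 0}"
    proof (cases "v$2 = 0")
      case False
      define u where "u = v - (v$4) *\<^sub>R axis 4 (1::real)"
      have u: "u$1 = v$1" "u$2 = v$2" "u$3 = v$3" "u$4 = 0"
        by (simp_all add: u_def axis_def)
      have "((v$2)\<^sup>2 + (v$3)\<^sup>2 - v$1 * v$3) / v$2 = v$4"
        using v False by (simp add: field_simps)
      then have "F u = v"
        unfolding F_def u by (simp add: u_def)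
      moreover have "u \<in> H"
        using False u by (simp add: H_def)
      ultimately show ?thesis by blast
    qed simp
  qed
  ultimately show ?thesis
    using hyperplane[of 2] negligible_Un negligible_subset by blast
qed

text \<open>The weights 3 count the tensor positions that hold \<open>b\<close> and
  \<open>c\<close>.\<close>

definition sq_dist_cube :: "real \<Rightarrow> real \<Rightarrow> real \<Rightarrow> real \<Rightarrow> real \<Rightarrow> real \<Rightarrow> real" where
  "sq_dist_cube a b c d p q =
     (a - p^3)\<^sup>2 + 3 * (b - p\<^sup>2 * q)\<^sup>2 + 3 * (c - p * q\<^sup>2)\<^sup>2 + (d - q^3)\<^sup>2"

lemma sq_dist_cube_critical:
  assumes min: "\<And>r s. sq_dist_cube a b c d p q \<le> sq_dist_cube a b c d r s"
  shows "(a - p^3) * p\<^sup>2 + 2 * (b - p\<^sup>2 * q) * p * q + (c - p * q\<^sup>2) * q\<^sup>2 = 0"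
    and "(b - p\<^sup>2 * q) * p\<^sup>2 + 2 * (c - p * q\<^sup>2) * p * q + (d - q^3) * q\<^sup>2 = 0"
proof -
  let ?D1 = "(a - p^3) * p\<^sup>2 + 2 * (b - p\<^sup>2 * q) * p * q + (c - p * q\<^sup>2) * q\<^sup>2"
  let ?D2 = "(b - p\<^sup>2 * q) * p\<^sup>2 + 2 * (c - p * q\<^sup>2) * p * q + (d - q^3) * q\<^sup>2"
  have "((\<lambda>r. sq_dist_cube a b c d r q) has_real_derivative - 6 * ?D1) (at p)"
    unfolding sq_dist_cube_def
    by (rule derivative_eq_intros refl | simp add: algebra_simps power2_eq_square power3_eq_cube)+
  from DERIV_local_min[OF this zero_less_one] min show "?D1 = 0" by simp
  have "((\<lambda>s. sq_dist_cube a b c d p s) has_real_derivative - 6 * ?D2) (at q)"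
    unfolding sq_dist_cube_def
    by (rule derivative_eq_intros refl | simp add: algebra_simps power2_eq_square power3_eq_cube)+
  from DERIV_local_min[OF this zero_less_one] min show "?D2 = 0" by simp
qed

text \<open>Along the line through (r, s) the squared distance is a quadratic in \<open>t^3\<close>
  whose least value lies \<open>?f\<^sup>2 / N\<close> below the value at 0. Minimality at the
  origin thus forces the whole cubic to vanish.\<close>

lemma sq_dist_cube_min_at_zero:
  assumes min: "\<And>r s. sq_dist_cube a b c d 0 0 \<le> sq_dist_cube a b c d r s"
  shows "a = 0 \<and> b = 0 \<and> c = 0 \<and> d = 0"
proof -
  have f0: "a * r^3 + 3 * b * r\<^sup>2 * s + 3 * c * r * s\<^sup>2 + d * s^3 = 0" (is "?f = 0")
    if "r \<noteq> 0 \<or> s \<noteq> 0" for r s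
  proof -
    define N where "N = (r\<^sup>2 + s\<^sup>2)^3"
    have N: "N > 0"
      using that unfolding N_def by (simp add: sum_power2_gt_zero_iff)
    \<comment> \<open>The vertex of the quadratic in \<open>t^3\<close>; a real cube root exists for
      either sign.\<close>
    define t where "t = root 3 (?f / N)"
    have t: "t^3 = ?f / N"
      by (simp add: t_def odd_real_root_pow)
    have "sq_dist_cube a b c d (t * r) (t * s) = sq_dist_cube a b c d 0 0 - 2 * t^3 * ?f + (t^3)\<^sup>2 * N"
      unfolding sq_dist_cube_def N_def
      by (simp add: algebra_simps power2_eq_square power3_eq_cube)
    then have "2 * t^3 * ?f \<le> (t^3)\<^sup>2 * N"
      using min[of "t * r" "t * s"] by linarith
    moreover have "2 * t^3 * ?f = 2 * (?f\<^sup>2 / N)"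
      unfolding t by (simp only: power2_eq_square times_divide_eq_left times_divide_eq_right mult.assoc)
    moreover have "(t^3)\<^sup>2 * N = ?f\<^sup>2 / N"
      using N unfolding t power_divide power2_eq_square[of N] by simp
    ultimately have "?f\<^sup>2 / N \<le> 0"
      by linarith
    then show ?thesis
      using N by (simp add: divide_le_0_iff)
  qed
  show ?thesis
    using f0[of 1 0] f0[of 0 1] f0[of 1 1] f0[of 1 "-1"] by simp
qed

text \<open>Every x equals ((x.y) y + (x.w) w) / n in the orthogonal basis y = (p, q), w = (-q, p).
  As g(y,y,.) = 0, only g(y,w,w) and g(w,w,w) survive in g(x,x,x), with denominator
  \<open>n^3\<close>.\<close>

lemma cubic_residual_factors:
  fixes p q :: real
  defines "n \<equiv> p\<^sup>2 + q\<^sup>2"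
  assumes n: "n \<noteq> 0"
    and 1: "a * p\<^sup>2 + 2 * b * p * q + c * q\<^sup>2 = 0"
    and 2: "b * p\<^sup>2 + 2 * c * p * q + d * q\<^sup>2 = 0"
  obtains \<gamma> \<delta> where
    "a = 3 * \<gamma> * p * q\<^sup>2 - \<delta> * q^3"
    "b = \<gamma> * (q^3 - 2 * p\<^sup>2 * q) + \<delta> * p * q\<^sup>2"
    "c = \<gamma> * (p^3 - 2 * p * q\<^sup>2) - \<delta> * p\<^sup>2 * q"
    "d = 3 * \<gamma> * p\<^sup>2 * q + \<delta> * p^3"
proof -
  \<comment> \<open>the values \<open>g(y,w,w)\<close> and \<open>g(w,w,w)\<close> for \<open>y = (p, q)\<close> and \<open>w = (-q, p)\<close>\<close>
  define G where "G = a * p * q\<^sup>2 + b * (q^3 - 2 * p\<^sup>2 * q) + c * (p^3 - 2 * p * q\<^sup>2) + d * p\<^sup>2 * q"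
  define D where "D = - a * q^3 + 3 * b * p * q\<^sup>2 - 3 * c * p\<^sup>2 * q + d * p^3"
  have "a = (3 * G * p * q\<^sup>2 - D * q^3) / n^3"
    using 1 2 n unfolding n_def G_def D_def by (subst nonzero_eq_divide_eq) (simp, algebra)
  moreover have "b = (G * (q^3 - 2 * p\<^sup>2 * q) + D * p * q\<^sup>2) / n^3"
    using 1 2 n unfolding n_def G_def D_def by (subst nonzero_eq_divide_eq) (simp, algebra)
  moreover have "c = (G * (p^3 - 2 * p * q\<^sup>2) - D * p\<^sup>2 * q) / n^3"
    using 1 2 n unfolding n_def G_def D_def by (subst nonzero_eq_divide_eq) (simp, algebra)
  moreover have "d = (3 * G * p\<^sup>2 * q + D * p^3) / n^3"
    using 1 2 n unfolding n_def G_def D_def by (subst nonzero_eq_divide_eq) (simp, algebra)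
  ultimately show thesis
    using n by (intro that[of "G / n^3" "D / n^3"])
      (simp_all add: add_divide_distrib diff_divide_distrib)
qed

lemma norm_sym_tensor_minus_cube:
  "(norm (sym_tensor v - cube y))\<^sup>2 = sq_dist_cube (v$1) (v$2) (v$3) (v$4) (y$1) (y$2)"
  by (simp add: norm_tensor_sq sum_2 sym_tensor_def of_slabs_def cube_def Let_def sq_dist_cube_def)
    (simp add: power2_eq_square power3_eq_cube algebra_simps)

lemma sym_tensor_minus_cube_in_D3:
  assumes v: "hessian_trace (v$1) (v$2) (v$3) (v$4) \<noteq> 0"
    and min: "\<And>z. (norm (sym_tensor v - cube y))\<^sup>2 \<le> (norm (sym_tensor v - cube z))\<^sup>2"
  shows "sym_tensor v - cube y \<in> D3"
proof -
  define a b c d p q where "a = v$1" and "b = v$2" and "c = v$3" and "d = v$4"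
    and "p = y$1" and "q = y$2"
  note coords = a_def b_def c_def d_def p_def q_def
  have min': "sq_dist_cube a b c d p q \<le> sq_dist_cube a b c d r s" for r s
    using min[of "vector [r, s]"] by (simp add: norm_sym_tensor_minus_cube coords)
  have "p \<noteq> 0 \<or> q \<noteq> 0"
    using sq_dist_cube_min_at_zero[of a b c d] min' v by (auto simp: coords hessian_trace_def)
  then have n: "p\<^sup>2 + q\<^sup>2 \<noteq> 0"
    by (simp add: sum_power2_eq_zero_iff)
  obtain \<gamma> \<delta> where g:
    "a - p^3 = 3 * \<gamma> * p * q\<^sup>2 - \<delta> * q^3"
    "b - p\<^sup>2 * q = \<gamma> * (q^3 - 2 * p\<^sup>2 * q) + \<delta> * p * q\<^sup>2"
    "c - p * q\<^sup>2 = \<gamma> * (p^3 - 2 * p * q\<^sup>2) - \<delta> * p\<^sup>2 * q"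
    "d - q^3 = 3 * \<gamma> * p\<^sup>2 * q + \<delta> * p^3"
    using cubic_residual_factors[OF n sq_dist_cube_critical[OF min']] by blast
  have "\<gamma> \<noteq> 0"
  proof
    assume "\<gamma> = 0"
    \<comment> \<open>The Hessian of \<open>(p x + q y)^3 + \<delta> (p y - q x)^3\<close> is a
      multiple of the product of these two orthogonal linear forms, hence trace-free.\<close>
    then have "hessian_trace a b c d = 0"
      using g unfolding hessian_trace_def by algebra
    then show False using v by (simp add: coords)
  qed
  \<comment> \<open>\<open>(S,S,S)\<cdot>C\<close> is the symmetrization of \<open>s \<otimes> s \<otimes> t\<close> for the columns \<open>s, t\<close> of \<open>S\<close>; take
    \<open>s = w\<close> and \<open>t = \<gamma> y + (\<delta>/3) w\<close>\<close>
  define S :: "real^2^2" where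
    "S = vector [vector [- q, \<gamma> * p - \<delta> / 3 * q], vector [p, \<gamma> * q + \<delta> / 3 * p]]"
  have "det S = - \<gamma> * (p\<^sup>2 + q\<^sup>2)"
    by (simp add: S_def det_2 algebra_simps power2_eq_square)
  then have "invertible S"
    using \<open>\<gamma> \<noteq> 0\<close> n by (simp add: invertible_det_nz)
  moreover have "sym_tensor v - cube y = multilinear_mult S S S C_tensor"
    using g
    by (simp add: vec_eq_iff forall_2 sum_2 sym_tensor_def of_slabs_def cube_def Let_def
        multilinear_mult_def C_tensor_def S_def flip: coords)
      (simp add: algebra_simps power2_eq_square power3_eq_cube)
  ultimately show ?thesis
    unfolding D3_def by blast
qed

theorem theorem7p1:
  "almost_every_symmetric (\<lambda>X. \<forall>Y. best_sym_rank1_approx X Y \<longrightarrow> X - Y \<in> D3)"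
proof -
  have "{v::real^4. hessian_trace (v$1) (v$2) (v$3) (v$4) = 0} \<in> null_sets lebesgue"
    using negligible_hessian_trace_zero by (simp add: negligible_iff_null_sets)
  from AE_not_in[OF this] show ?thesis
    unfolding almost_every_symmetric_def best_sym_rank1_approx_def
    by eventually_elim (auto intro: sym_tensor_minus_cube_in_D3)
qed

end
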